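(* Let $F$ be a pythagorean ordered field and let $(V,b)$ be a bilinear space of dimension $n\geqslant3$ over $F$ whose quadratic form $q(x)=b(x,x)$ is isometric to $x_1^2+\cdots+x_n^2$. If $F$ carries a non-archimedean ordering, then $\mathrm{SO}(V)$ contains a proper non-central normal subgroup, i.e. a normal subgroup $N\neq\mathrm{SO}(V)$ that is not contained in the center of $\mathrm{SO}(V)$.
   Context: A field is pythagorean if every sum of squares in it is a square. An ordered field here means a formally real field, i.e. a field in which $-1$ is not a sum of squares (equivalently, one admitting a field ordering). An ordering of $F$ is non-archimedean if there is an element of $F$ larger than every positive integer with respect to it. A bilinear space $(V,b)$ is a finite-dimensional $F$-vector space with a nondegenerate symmetric bilinear form $b$. $\mathrm{O}(V)$ is the group of isometries of $(V,b)$, and $\mathrm{SO}(V)$ (the rotation group) is its subgroup of elements of determinant $1$. *)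

theory Defs
  imports "HOL-Algebra.Coset" "Jordan_Normal_Form.Determinant"
begin

section \<open>Fields and their orderings\<close>

definition sum_of_squares :: "'a::field \<Rightarrow> bool" where
  "sum_of_squares a \<longleftrightarrow> (\<exists>xs. a = (\<Sum>x\<leftarrow>xs. x\<^sup>2))"

definition pythagorean_field :: "'a::field itself \<Rightarrow> bool" where
  "pythagorean_field _ \<longleftrightarrow> (\<forall>a::'a. sum_of_squares a \<longrightarrow> (\<exists>y. a = y\<^sup>2))"

definition formally_real_field :: "'a::field itself \<Rightarrow> bool" where
  "formally_real_field _ \<longleftrightarrow> \<not> sum_of_squares (- 1 :: 'a)"

text \<open>
  An ordering is a relation on the field, and not a type class instance, since a formally real
  field may carry many orderings.
\<close>

definition field_ordering :: "('a::field \<Rightarrow> 'a \<Rightarrow> bool) \<Rightarrow> bool" where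
  "field_ordering leq \<longleftrightarrow>
     class.linorder leq (\<lambda>x y. leq x y \<and> x \<noteq> y) \<and>
     (\<forall>x y z. leq x y \<longrightarrow> leq (z + x) (z + y)) \<and>
     (\<forall>x y. leq 0 x \<longrightarrow> leq 0 y \<longrightarrow> leq 0 (x * y))"

definition non_archimedean :: "('a::field \<Rightarrow> 'a \<Rightarrow> bool) \<Rightarrow> bool" where
  "non_archimedean leq \<longleftrightarrow> (\<exists>x. \<forall>m::nat. 0 < m \<longrightarrow> leq (of_nat m) x \<and> of_nat m \<noteq> x)"

section \<open>Bilinear spaces\<close>

locale bilinear_space = vector_space scale
  for scale :: "'a::field \<Rightarrow> 'v::ab_group_add \<Rightarrow> 'v" +
  fixes b :: "'v \<Rightarrow> 'v \<Rightarrow> 'a"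
  assumes finite_dimensional: "\<exists>B. finite_dimensional_vector_space scale B"
    and linear_right: "Vector_Spaces.linear scale (*) (\<lambda>y. b x y)"
    and linear_left: "Vector_Spaces.linear scale (*) (\<lambda>x. b x y)"
    and symmetric: "b x y = b y x"
    and nondegenerate: "(\<And>y. b x y = 0) \<Longrightarrow> x = 0"
begin

definition quadratic_form :: "'v \<Rightarrow> 'a" where
  "quadratic_form x = b x x"

definition isometric_to_sum_of_squares :: "nat \<Rightarrow> bool" where
  "isometric_to_sum_of_squares n \<longleftrightarrow>
     (\<exists>f. bij_betw f UNIV (carrier_vec n) \<and>
          (\<forall>x y. f (x + y) = f x + f y) \<and>
          (\<forall>c x. f (scale c x) = c \<cdot>\<^sub>v f x) \<and>
          (\<forall>x. quadratic_form x = (\<Sum>i<n. (f x $ i)\<^sup>2)))"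

subsection \<open>The determinant of an endomorphism\<close>

definition ordered_basis :: "'v list \<Rightarrow> bool" where
  "ordered_basis bs \<longleftrightarrow> distinct bs \<and> independent (set bs) \<and> span (set bs) = UNIV"

definition matrix_of :: "'v list \<Rightarrow> 'v list \<Rightarrow> ('v \<Rightarrow> 'v) \<Rightarrow> 'a mat" where
  "matrix_of bs cs f =
     mat (length cs) (length bs) (\<lambda>(i, j). representation (set cs) (f (bs ! j)) (cs ! i))"

text \<open>
  The choice of the basis does not matter, see \<open>endo_det_eq\<close> below. The definition
  is meaningful only for linear endomorphisms of finite-dimensional spaces.
\<close>

definition endo_det :: "('v \<Rightarrow> 'v) \<Rightarrow> 'a" where
  "endo_det f = (let bs = (SOME bs. ordered_basis bs) in det (matrix_of bs bs f))"

lemma matrix_of_carrier: "matrix_of bs cs f \<in> carrier_mat (length cs) (length bs)"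
  by (simp add: matrix_of_def)

lemma matrix_of_id:
  assumes "ordered_basis bs"
  shows "matrix_of bs bs id = 1\<^sub>m (length bs)"
  using assms
  by (intro eq_matI)
     (auto simp: matrix_of_def ordered_basis_def representation_basis nth_eq_iff_index_eq)

lemma matrix_of_comp:
  assumes cs: "ordered_basis cs" and ds: "ordered_basis ds"
    and g: "Vector_Spaces.linear scale scale g"
  shows "matrix_of cs ds g * matrix_of bs cs f = matrix_of bs ds (g \<circ> f)"
proof (intro eq_matI)
  interpret g: Vector_Spaces.linear scale scale g by fact
  fix i j
  assume "i < dim_row (matrix_of bs ds (g \<circ> f))" and "j < dim_col (matrix_of bs ds (g \<circ> f))"
  then have i: "i < length ds" and j: "j < length bs"
    by (simp_all add: matrix_of_def)
  let ?r = "representation (set cs) (f (bs ! j))" and ?d = "ds ! i"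
  interpret r: Vector_Spaces.linear scale "(*)" "\<lambda>v. representation (set ds) v ?d"
    using ds by (intro linear_representation) (auto simp: ordered_basis_def)
  have "f (bs ! j) = (\<Sum>c\<in>set cs. scale (?r c) c)"
    using cs by (subst sum_representation_eq) (auto simp: ordered_basis_def)
  then have "representation (set ds) (g (f (bs ! j))) ?d
      = representation (set ds) (g (\<Sum>c\<in>set cs. scale (?r c) c)) ?d"
    by (rule arg_cong)
  also have "\<dots> = (\<Sum>c\<in>set cs. ?r c * representation (set ds) (g c) ?d)"
    by (simp only: g.sum g.scale r.sum r.scale)
  also have "\<dots> = (\<Sum>k = 0..<length cs. ?r (cs ! k) * representation (set ds) (g (cs ! k)) ?d)"
    using cs unfolding ordered_basis_def
    by (intro sum.reindex_bij_betw [symmetric])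
       (auto simp: bij_betw_def inj_on_def nth_eq_iff_index_eq set_conv_nth)
  finally show "(matrix_of cs ds g * matrix_of bs cs f) $$ (i, j)
      = matrix_of bs ds (g \<circ> f) $$ (i, j)"
    using i j by (simp add: matrix_of_def scalar_prod_def mult.commute)
qed (simp_all add: matrix_of_def)

lemma endo_det_eq:
  assumes bs: "ordered_basis bs" and f: "Vector_Spaces.linear scale scale f"
  shows "endo_det f = det (matrix_of bs bs f)"
proof -
  define cs where "cs = (SOME cs. ordered_basis cs)"
  have cs: "ordered_basis cs"
    unfolding cs_def by (rule someI) (rule bs)
  have len: "length cs = length bs"
    using bs cs unfolding ordered_basis_def
    by (metis dim_eq_card distinct_card)
  have id: "Vector_Spaces.linear scale scale id"
    by (rule linear_id)
  define P where "P = matrix_of bs cs id"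
  define Q where "Q = matrix_of cs bs id"
  define A where "A = matrix_of bs bs f"
  have carr: "P \<in> carrier_mat (length bs) (length bs)" "Q \<in> carrier_mat (length bs) (length bs)"
    "A \<in> carrier_mat (length bs) (length bs)"
    using len by (auto simp: P_def Q_def A_def matrix_of_def)
  have "P * Q = 1\<^sub>m (length bs)"
    using matrix_of_comp [OF bs cs id, of cs id] matrix_of_id [OF cs] len
    by (simp add: P_def Q_def)
  then have PQ: "det P * det Q = 1"
    using det_mult [OF carr(1,2)] by simp
  have "matrix_of cs cs f = P * (A * Q)"
    using matrix_of_comp [OF bs bs f, of cs id] matrix_of_comp [OF bs cs id, of cs f]
    by (simp add: P_def Q_def A_def)
  then have "det (matrix_of cs cs f) = det P * (det A * det Q)"
    using det_mult [OF carr(1), of "A * Q"] det_mult [OF carr(3,2)] carr by simp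
  then have "det (matrix_of cs cs f) = det A"
    using PQ by (simp add: mult.left_commute)
  then show ?thesis
    by (simp add: endo_det_def cs_def A_def Let_def)
qed

subsection \<open>The orthogonal group and the rotation group\<close>

definition isometry :: "('v \<Rightarrow> 'v) \<Rightarrow> bool" where
  "isometry f \<longleftrightarrow> Vector_Spaces.linear scale scale f \<and> bij f \<and> (\<forall>x y. b (f x) (f y) = b x y)"

definition orthogonal_group :: "('v \<Rightarrow> 'v) monoid" where
  "orthogonal_group = \<lparr>carrier = {f. isometry f}, monoid.mult = (\<circ>), one = id\<rparr>"

definition rotation_group :: "('v \<Rightarrow> 'v) monoid" where
  "rotation_group =
     orthogonal_group\<lparr>carrier := {f \<in> carrier orthogonal_group. endo_det f = 1}\<rparr>"

lemma obtain_ordered_basis: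
  obtains bs where "ordered_basis bs"
proof -
  obtain B where "finite_dimensional_vector_space scale B"
    using finite_dimensional by blast
  then interpret B: finite_dimensional_vector_space scale B .
  obtain bs where "set bs = B" "distinct bs"
    using finite_distinct_list [OF B.finite_Basis] by blast
  then show ?thesis
    using that B.independent_Basis B.span_Basis by (auto simp: ordered_basis_def)
qed

lemma endo_det_id: "endo_det id = 1"
proof -
  obtain bs where "ordered_basis bs" by (rule obtain_ordered_basis)
  then show ?thesis
    by (simp add: endo_det_eq [OF _ linear_id] matrix_of_id)
qed

lemma endo_det_comp:
  assumes "Vector_Spaces.linear scale scale f" and "Vector_Spaces.linear scale scale g"
  shows "endo_det (g \<circ> f) = endo_det g * endo_det f"
proof -
  obtain bs where bs: "ordered_basis bs" by (rule obtain_ordered_basis)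
  have "Vector_Spaces.linear scale scale (g \<circ> f)"
    using assms by (rule Vector_Spaces.linear_compose)
  then show ?thesis
    using det_mult [OF matrix_of_carrier [of bs bs g] matrix_of_carrier [of bs bs f]]
    by (simp add: endo_det_eq [OF bs] assms matrix_of_comp [OF bs bs])
qed

lemma isometry_inv:
  assumes "isometry f"
  shows "isometry (inv_into UNIV f)"
proof -
  have f: "Vector_Spaces.linear scale scale f" "bij f" and b: "\<And>x y. b (f x) (f y) = b x y"
    using assms by (auto simp: isometry_def)
  interpret f: Vector_Spaces.linear scale scale f by fact
  have s: "f (inv_into UNIV f x) = x" for x
    using f(2) by (simp add: bij_is_surj surj_f_inv_f)
  have i: "inv_into UNIV f (f x) = x" for x
    using f(2) by (simp add: bij_is_inj)
  have "inv_into UNIV f (x + y) = inv_into UNIV f x + inv_into UNIV f y" for x y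
    by (metis f.add i s)
  moreover have "inv_into UNIV f (scale c x) = scale c (inv_into UNIV f x)" for c x
    by (metis f.scale i s)
  moreover have "b (inv_into UNIV f x) (inv_into UNIV f y) = b x y" for x y
    by (metis b s)
  ultimately show ?thesis
    using f(2)
    by (auto simp: isometry_def bij_imp_bij_inv module_hom_iff_linear [symmetric] module_hom_iff
        module_axioms)
qed

lemma isometry_comp: "isometry f \<Longrightarrow> isometry g \<Longrightarrow> isometry (g \<circ> f)"
  by (auto simp: isometry_def intro: Vector_Spaces.linear_compose bij_comp)

lemma isometry_id: "isometry id"
  by (simp add: isometry_def linear_id)

lemma group_orthogonal_group: "group orthogonal_group"
proof (rule groupI)
  fix f assume "f \<in> carrier orthogonal_group"
  then have "isometry f" by (simp add: orthogonal_group_def)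
  then show "\<exists>g\<in>carrier orthogonal_group.
      g \<otimes>\<^bsub>orthogonal_group\<^esub> f = \<one>\<^bsub>orthogonal_group\<^esub>"
    by (intro bexI [of _ "inv_into UNIV f"])
       (use \<open>isometry f\<close> in
          \<open>auto simp: orthogonal_group_def isometry_inv isometry_def [of f] bij_is_inj\<close>)
qed (auto simp: orthogonal_group_def isometry_comp isometry_id comp_assoc)

lemma group_rotation_group: "group rotation_group"
proof (rule groupI)
  fix f assume "f \<in> carrier rotation_group"
  then have f: "isometry f" "endo_det f = 1"
    by (auto simp: rotation_group_def orthogonal_group_def)
  have inverse: "isometry (inv_into UNIV f)" "inv_into UNIV f \<circ> f = id"
    using f(1) by (auto simp: isometry_inv isometry_def [of f] bij_is_inj)
  then have "endo_det (inv_into UNIV f) = 1"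
    using endo_det_comp [of f "inv_into UNIV f"] f endo_det_id by (simp add: isometry_def)
  then show "\<exists>g\<in>carrier rotation_group. g \<otimes>\<^bsub>rotation_group\<^esub> f = \<one>\<^bsub>rotation_group\<^esub>"
    using inverse by (intro bexI [of _ "inv_into UNIV f"]) (auto simp: rotation_group_def orthogonal_group_def)
qed (auto simp: rotation_group_def orthogonal_group_def isometry_comp isometry_id comp_assoc
       endo_det_id endo_det_comp isometry_def [THEN iffD1])

end

section \<open>The center of a group\<close>

definition group_center :: "('g, 'm) monoid_scheme \<Rightarrow> 'g set" where
  "group_center G = {z \<in> carrier G. \<forall>x\<in>carrier G. z \<otimes>\<^bsub>G\<^esub> x = x \<otimes>\<^bsub>G\<^esub> z}"

end

theory Submission
  imports Defs
begin

text \<open>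
  Fix a non-archimedean ordering. The rotations \<open>f\<close> that move every vector only infinitesimally,
  \<open>m q(f x - x) \<le> q(x)\<close> for all natural \<open>m\<close>, form a normal subgroup, because this condition is
  stated in terms of \<open>q\<close> alone. It does not contain the product of the reflections in two
  orthonormal vectors. If \<open>X\<close> is infinitely large, it does contain the product of the
  reflections in \<open>X e\<^sub>1 + e\<^sub>2\<close> and \<open>X e\<^sub>1 - e\<^sub>2\<close>, a rotation by an infinitesimal angle which
  does not commute with the product of the reflections in \<open>e\<^sub>2\<close> and \<open>e\<^sub>3\<close>.
\<close>

section \<open>Arithmetic of a field ordering given as a relation\<close>

locale ordering_of_field =
  fixes leq :: "'a::field \<Rightarrow> 'a \<Rightarrow> bool"
  assumes field_ordering: "field_ordering leq"
begin

lemma leq_linorder: "class.linorder leq (\<lambda>x y. leq x y \<and> x \<noteq> y)"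
  using field_ordering by (simp add: field_ordering_def)

lemma leq_refl: "leq x x"
  using leq_linorder
  by (simp add: class.linorder_def class.order_def class.preorder_def)

lemma leq_trans: "leq x y \<Longrightarrow> leq y z \<Longrightarrow> leq x z"
  using leq_linorder
  unfolding class.linorder_def class.order_def class.preorder_def by blast

lemma leq_antisym: "leq x y \<Longrightarrow> leq y x \<Longrightarrow> x = y"
  using leq_linorder
  by (simp add: class.linorder_def class.order_def class.order_axioms_def)

lemma leq_total: "leq x y \<or> leq y x"
  using leq_linorder
  by (simp add: class.linorder_def class.linorder_axioms_def)

lemma leq_add_left: "leq x y \<Longrightarrow> leq (z + x) (z + y)"
  using field_ordering by (simp add: field_ordering_def)

lemma leq_iff_diff: "leq x y \<longleftrightarrow> leq 0 (y - x)"
  using leq_add_left [of x y "- x"] leq_add_left [of 0 "y - x" x] by auto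

lemma add_nonneg: "leq 0 x \<Longrightarrow> leq 0 y \<Longrightarrow> leq 0 (x + y)"
  using leq_add_left [of 0 y x] leq_trans [of 0 x "x + y"] by simp

lemma mult_nonneg: "leq 0 x \<Longrightarrow> leq 0 y \<Longrightarrow> leq 0 (x * y)"
  using field_ordering by (simp add: field_ordering_def)

lemma square_nonneg: "leq 0 (x\<^sup>2)"
proof -
  have "leq 0 x \<or> leq 0 (- x)"
    using leq_total [of 0 x] leq_add_left [of x 0 "- x"] by auto
  then show ?thesis
    using mult_nonneg [of x x] mult_nonneg [of "- x" "- x"] by (auto simp: power2_eq_square)
qed

text \<open>If \<open>x\<close> were negative, adding \<open>x\<close> to x \<le> 0 would give 2x
  \<le> x, hence 0 \<le> 2x \<le> x. This cancels a factor 2 without inverting it.\<close>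

lemma nonneg_of_double_nonneg:
  assumes "leq 0 (2 * x)"
  shows "leq 0 x"
proof (cases "leq 0 x")
  case False
  then have "leq (x + x) (x + 0)"
    using leq_total by (blast intro: leq_add_left)
  moreover have "leq 0 (x + x)"
    using assms by (simp only: mult_2)
  ultimately show ?thesis
    by (metis leq_trans add_0_right)
qed

lemma one_nonneg: "leq 0 1"
  using square_nonneg [of 1] by simp

lemma of_nat_nonneg: "leq 0 (of_nat m)"
  by (induction m) (auto intro: leq_refl add_nonneg one_nonneg)

lemma sum_nonneg:
  assumes "\<And>i. i \<in> I \<Longrightarrow> leq 0 (f i)"
  shows "leq 0 (sum f I)"
  using assms
  by (induction I rule: infinite_finite_induct) (auto intro: leq_refl add_nonneg)

text \<open>Otherwise -1 = m + x would be nonnegative. This replaces strict positivity: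
  \<open>x = 0\<close> yields characteristic zero, and a square \<open>x\<close> makes
  \<open>1 + X\<^sup>2\<close> an admissible denominator.\<close>

lemma of_nat_Suc_add_nonneg_neq_0:
  assumes "leq 0 x"
  shows "of_nat (Suc m) + x \<noteq> 0"
proof
  assume "of_nat (Suc m) + x = 0"
  then have "of_nat m + x = - 1"
    by (simp add: algebra_simps eq_neg_iff_add_eq_0)
  then have "leq 0 (- 1)"
    using add_nonneg [OF of_nat_nonneg assms, of m] by simp
  then have "leq 1 0"
    by (subst leq_iff_diff) simp
  then show False
    using leq_antisym [OF one_nonneg] by simp
qed

lemma of_nat_Suc_neq_0: "(of_nat (Suc m) :: 'a) \<noteq> 0"
  using of_nat_Suc_add_nonneg_neq_0 [OF leq_refl, of m] by simp

lemma two_neq_0: "(2 :: 'a) \<noteq> 0"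
  using of_nat_Suc_neq_0 [of 1] by simp

lemma one_add_square_neq_0: "1 + (x :: 'a)\<^sup>2 \<noteq> 0"
  using of_nat_Suc_add_nonneg_neq_0 [OF square_nonneg [of x], of 0] by simp

end

section \<open>Isometries, the rotation group and reflections\<close>

context bilinear_space
begin

lemma b_add_left: "b (x + y) z = b x z + b y z"
  and b_diff_left: "b (x - y) z = b x z - b y z"
  and b_scale_left: "b (scale c x) z = c * b x z"
  and b_minus_left: "b (- x) z = - b x z"
proof -
  interpret l: Vector_Spaces.linear scale "(*)" "\<lambda>x. b x z" by (rule linear_left)
  show "b (x + y) z = b x z + b y z" "b (x - y) z = b x z - b y z" "b (scale c x) z = c * b x z"
      "b (- x) z = - b x z"
    by (rule l.add l.diff l.scale l.neg)+
qed

lemma b_add_right: "b z (x + y) = b z x + b z y"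
  and b_diff_right: "b z (x - y) = b z x - b z y"
  and b_scale_right: "b z (scale c x) = c * b z x"
  and b_minus_right: "b z (- x) = - b z x"
  using b_add_left b_diff_left b_scale_left b_minus_left by (metis symmetric)+

lemmas b_bilinear =
  b_add_left b_diff_left b_scale_left b_minus_left
  b_add_right b_diff_right b_scale_right b_minus_right

lemma quadratic_form_add:
  "quadratic_form (x + y) = quadratic_form x + 2 * b x y + quadratic_form y"
  by (simp add: quadratic_form_def b_bilinear symmetric [of y x])

lemma quadratic_form_diff:
  "quadratic_form (x - y) = quadratic_form x - 2 * b x y + quadratic_form y"
  by (simp add: quadratic_form_def b_bilinear symmetric [of y x])

lemma quadratic_form_scale: "quadratic_form (scale c x) = c\<^sup>2 * quadratic_form x"
  by (simp add: quadratic_form_def b_bilinear power2_eq_square)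

lemma quadratic_form_minus_commute: "quadratic_form (x - y) = quadratic_form (y - x)"
  by (simp add: quadratic_form_diff symmetric [of x y])

lemma isometry_b: "isometry f \<Longrightarrow> b (f x) (f y) = b x y"
  by (simp add: isometry_def)

lemma isometry_quadratic_form: "isometry f \<Longrightarrow> quadratic_form (f x) = quadratic_form x"
  by (simp add: isometry_def quadratic_form_def)

lemma isometry_linear: "isometry f \<Longrightarrow> Vector_Spaces.linear scale scale f"
  by (simp add: isometry_def)

lemma isometry_diff: "isometry f \<Longrightarrow> f (x - y) = f x - f y"
  by (metis isometry_linear module_hom.diff module_hom_iff_linear)

lemma isometry_f_inv: "isometry f \<Longrightarrow> f (inv_into UNIV f x) = x"
  by (simp add: isometry_def bij_is_surj surj_f_inv_f)

lemma carrier_rotation_group: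
  "f \<in> carrier rotation_group \<longleftrightarrow> isometry f \<and> endo_det f = 1"
  by (simp add: rotation_group_def orthogonal_group_def)

lemma mult_rotation_group: "f \<otimes>\<^bsub>rotation_group\<^esub> g = f \<circ> g"
  and one_rotation_group: "\<one>\<^bsub>rotation_group\<^esub> = id"
  by (simp_all add: rotation_group_def orthogonal_group_def)

lemma inv_rotation_group:
  assumes "f \<in> carrier rotation_group"
  shows "inv\<^bsub>rotation_group\<^esub> f = inv_into UNIV f"
proof -
  have "inv\<^bsub>rotation_group\<^esub> f \<circ> f = id"
    using group.l_inv [OF group_rotation_group assms]
    by (simp add: mult_rotation_group one_rotation_group)
  moreover have "bij f"
    using assms by (simp add: carrier_rotation_group isometry_def)
  ultimately show ?thesis
    by (metis bij_is_surj comp_assoc comp_id id_comp surj_iff)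
qed

text \<open>The orthogonal reflection in the hyperplane orthogonal to \<open>v\<close>. If
  \<open>quadratic_form v = 0\<close>, division by zero yields 0 and the map is the identity, so it
  is linear for every \<open>v\<close>.\<close>

definition reflection :: "'v \<Rightarrow> 'v \<Rightarrow> 'v" where
  "reflection v x = x - scale (2 * b x v / quadratic_form v) v"

lemma linear_reflection: "Vector_Spaces.linear scale scale (reflection v)"
proof -
  have "reflection v (x + y) = reflection v x + reflection v y" for x y
    by (simp add: reflection_def b_add_left distrib_left add_divide_distrib scale_left_distrib)
  moreover have "reflection v (scale c x) = scale c (reflection v x)" for c x
    by (simp add: reflection_def b_scale_left scale_right_diff_distrib mult.left_commute)
  ultimately show ?thesis
    by (simp add: module_hom_iff_linear [symmetric] module_hom_iff module_axioms)
qed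

text \<open>Reflecting negates the product with \<open>v\<close>, so the second application adds
  back the multiple of \<open>v\<close> that the first one subtracted.\<close>

lemma reflection_reflection:
  assumes "quadratic_form v \<noteq> 0"
  shows "reflection v (reflection v x) = x"
proof -
  have "b (reflection v x) v = - b x v"
    using assms by (simp add: reflection_def b_bilinear quadratic_form_def)
  then have "reflection v (reflection v x)
      = reflection v x + scale (2 * b x v / quadratic_form v) v"
    by (subst reflection_def) simp
  then show ?thesis
    by (simp add: reflection_def)
qed

lemma isometry_reflection:
  assumes "quadratic_form v \<noteq> 0"
  shows "isometry (reflection v)"
proof -
  have "bij (reflection v)"
    using reflection_reflection [OF assms] by (intro involuntory_imp_bij)
  moreover have "b (reflection v x) (reflection v y) = b x y" for x y
    using assms
    by (simp add: reflection_def b_bilinear quadratic_form_def symmetric [of v y])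
  ultimately show ?thesis
    by (simp add: isometry_def linear_reflection)
qed

text \<open>Equal values of the form at \<open>u\<close> and \<open>v\<close> give 2 b(u, u - v) =
  q(u - v), so the coefficient in \<open>reflection\<close> is 1 and u - (u - v) = v
  remains.\<close>

lemma reflection_swap:
  assumes "quadratic_form u = quadratic_form v" and "quadratic_form (u - v) \<noteq> 0"
  shows "reflection (u - v) u = v"
proof -
  have "2 * b u (u - v) = quadratic_form (u - v)"
    using assms(1) by (simp add: quadratic_form_diff b_bilinear) (simp add: quadratic_form_def)
  then show ?thesis
    using assms(2) by (simp add: reflection_def)
qed

lemma isometry_conjugate_reflection:
  assumes "isometry g"
  shows "g \<circ> reflection v = reflection (g v) \<circ> g"
proof -
  interpret g: Vector_Spaces.linear scale scale g
    using assms by (rule isometry_linear)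
  show ?thesis
    using assms
    by (auto simp: reflection_def g.diff g.scale isometry_b isometry_quadratic_form)
qed

text \<open>A reflection is an involution. For a product of two reflections with equal determinants,
  the square is the only value required.\<close>

lemma endo_det_reflection_square:
  assumes "quadratic_form v \<noteq> 0"
  shows "endo_det (reflection v) * endo_det (reflection v) = 1"
proof -
  have "reflection v \<circ> reflection v = id"
    using assms by (auto simp: reflection_reflection)
  then show ?thesis
    using endo_det_comp [OF linear_reflection linear_reflection, of v v] endo_det_id by simp
qed

text \<open>The two reflections are conjugate, so no determinant has to be computed.\<close>

lemma reflection_comp_rotation:
  assumes "quadratic_form u = quadratic_form v" and "quadratic_form v \<noteq> 0"
    and "quadratic_form (u - v) \<noteq> 0"
  shows "reflection u \<circ> reflection v \<in> carrier rotation_group"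
proof -
  let ?g = "reflection (u - v)"
  have "?g \<circ> reflection u = reflection v \<circ> ?g"
    using isometry_conjugate_reflection [OF isometry_reflection [OF assms(3)], of u]
      reflection_swap [OF assms(1,3)] by simp
  then have "endo_det ?g * endo_det (reflection u) = endo_det (reflection v) * endo_det ?g"
    by (metis endo_det_comp linear_reflection)
  moreover have "endo_det ?g \<noteq> 0"
    using endo_det_reflection_square [OF assms(3)] by auto
  ultimately have "endo_det (reflection u) = endo_det (reflection v)"
    by simp
  then show ?thesis
    using assms endo_det_reflection_square [OF assms(2)]
    by (simp add: carrier_rotation_group isometry_comp isometry_reflection endo_det_comp
        linear_reflection)
qed

end

section \<open>The normal subgroup of infinitesimal rotations\<close>

locale nonneg_bilinear_space = bilinear_space scale b + ordering_of_field leq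
  for scale :: "'a::field \<Rightarrow> 'v::ab_group_add \<Rightarrow> 'v" and b :: "'v \<Rightarrow> 'v \<Rightarrow> 'a"
    and leq :: "'a \<Rightarrow> 'a \<Rightarrow> bool" +
  assumes quadratic_form_nonneg: "leq 0 (quadratic_form x)"
begin

text \<open>Squared lengths avoid square roots, and multiplying by \<open>m\<close> avoids a
  quotient by q(x), which vanishes at 0. The instance \<open>m = 0\<close> holds because the form is
  nonnegative.\<close>

definition infinitesimal_rotations :: "('v \<Rightarrow> 'v) set" where
  "infinitesimal_rotations =
     {f \<in> carrier rotation_group.
        \<forall>x m. leq (of_nat m * quadratic_form (f x - x)) (quadratic_form x)}"

lemma infinitesimal_rotationsD:
  "f \<in> infinitesimal_rotations \<Longrightarrow>
    leq (of_nat m * quadratic_form (f x - x)) (quadratic_form x)"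
  by (simp add: infinitesimal_rotations_def)

text \<open>The displacement of \<open>x\<close> is the sum of those of \<open>g x\<close> under
  \<open>f\<close> and of \<open>x\<close> under \<open>g\<close>. The parallelogram law q(y + z) =
  2 q(y) + 2 q(z) - q(y - z) serves as the triangle inequality.\<close>

lemma infinitesimal_rotations_comp:
  assumes "f \<in> infinitesimal_rotations" and "g \<in> infinitesimal_rotations"
  shows "f \<circ> g \<in> infinitesimal_rotations"
proof -
  have g: "isometry g"
    using assms(2) by (auto simp: infinitesimal_rotations_def carrier_rotation_group)
  have "leq (of_nat m * quadratic_form (f (g x) - x)) (quadratic_form x)" for x m
  proof -
    define d e where "d = quadratic_form (f (g x) - g x)" and "e = quadratic_form (g x - x)"
    define s where "s = quadratic_form ((f (g x) - g x) - (g x - x))"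
    have sum: "quadratic_form (f (g x) - x) = 2 * d + 2 * e - s"
      using quadratic_form_add [of "f (g x) - g x" "g x - x"]
        quadratic_form_diff [of "f (g x) - g x" "g x - x"]
      by (simp add: d_def e_def s_def)
    \<comment> \<open>The factor 4 is chosen so that half the sum of both bounds is exactly q(x) - m
      (2d + 2e).\<close>
    have "leq 0 (quadratic_form x - of_nat (4 * m) * d)"
      and "leq 0 (quadratic_form x - of_nat (4 * m) * e)"
      using infinitesimal_rotationsD [OF assms(1), of "4 * m" "g x"]
        infinitesimal_rotationsD [OF assms(2), of "4 * m" x]
      by (simp_all only: d_def e_def leq_iff_diff [symmetric] isometry_quadratic_form [OF g])
    from add_nonneg [OF this]
    have "leq 0 (2 * (quadratic_form x - of_nat m * (2 * d + 2 * e)))"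
      by (simp add: algebra_simps)
    then have "leq 0 (quadratic_form x - of_nat m * (2 * d + 2 * e))"
      by (rule nonneg_of_double_nonneg)
    from add_nonneg [OF this mult_nonneg [OF of_nat_nonneg [of m] quadratic_form_nonneg]]
    have "leq 0 (quadratic_form x - of_nat m * (2 * d + 2 * e) + of_nat m * s)"
      by (simp add: s_def)
    then show ?thesis
      by (subst leq_iff_diff) (simp add: sum algebra_simps)
  qed
  moreover have "f \<circ> g \<in> carrier rotation_group"
    using assms
    by (simp add: infinitesimal_rotations_def carrier_rotation_group isometry_comp endo_det_comp
        isometry_linear)
  ultimately show ?thesis
    by (simp add: infinitesimal_rotations_def)
qed

text \<open>With \<open>x = f y\<close> the displacement of \<open>x\<close> under the inverse is y
  - f y, the negative of that of \<open>y\<close> under \<open>f\<close>, and q(x) = q(y).\<close>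

lemma infinitesimal_rotations_inv:
  assumes "f \<in> infinitesimal_rotations"
  shows "inv\<^bsub>rotation_group\<^esub> f \<in> infinitesimal_rotations"
proof -
  have f: "f \<in> carrier rotation_group" "isometry f"
    using assms by (auto simp: infinitesimal_rotations_def carrier_rotation_group)
  have "leq (of_nat m * quadratic_form (inv_into UNIV f x - x)) (quadratic_form x)" for x m
  proof -
    define y where "y = inv_into UNIV f x"
    have "f y = x"
      by (simp add: y_def isometry_f_inv f)
    moreover have "leq (of_nat m * quadratic_form (f y - y)) (quadratic_form (f y))"
      using assms f by (simp add: infinitesimal_rotations_def isometry_quadratic_form)
    ultimately show ?thesis
      by (simp add: y_def quadratic_form_minus_commute)
  qed
  then show ?thesis
    using f(1) group.inv_closed [OF group_rotation_group f(1)]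
    by (simp add: infinitesimal_rotations_def inv_rotation_group)
qed

text \<open>With \<open>x = g y\<close> the displacement of \<open>x\<close> under the conjugate is
  g (f y - y), and \<open>g\<close> preserves the form.\<close>

lemma infinitesimal_rotations_conjugate:
  assumes f: "f \<in> infinitesimal_rotations" and g: "g \<in> carrier rotation_group"
  shows "g \<otimes>\<^bsub>rotation_group\<^esub> f \<otimes>\<^bsub>rotation_group\<^esub> inv\<^bsub>rotation_group\<^esub> g
    \<in> infinitesimal_rotations"
proof -
  interpret R: group rotation_group by (rule group_rotation_group)
  have g': "isometry g"
    using g by (simp add: carrier_rotation_group)
  have "leq (of_nat m * quadratic_form (g (f (inv_into UNIV g x)) - x)) (quadratic_form x)" for x m
  proof -
    define y where "y = inv_into UNIV g x"
    have x: "x = g y"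
      by (simp add: y_def isometry_f_inv g')
    have "quadratic_form (g (f y) - g y) = quadratic_form (f y - y)"
      by (simp flip: isometry_diff [OF g'] add: isometry_quadratic_form g')
    then have "leq (of_nat m * quadratic_form (g (f y) - g y)) (quadratic_form (g y))"
      using f by (simp add: infinitesimal_rotations_def isometry_quadratic_form g')
    then show ?thesis
      by (simp add: x [symmetric]) (simp add: y_def)
  qed
  moreover have "g \<otimes>\<^bsub>rotation_group\<^esub> f \<otimes>\<^bsub>rotation_group\<^esub> inv\<^bsub>rotation_group\<^esub> g
      \<in> carrier rotation_group"
    using f g by (simp add: infinitesimal_rotations_def)
  ultimately show ?thesis
    by (simp add: infinitesimal_rotations_def mult_rotation_group inv_rotation_group g)
qed

lemma infinitesimal_rotations_normal: "infinitesimal_rotations \<lhd> rotation_group"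
proof -
  interpret R: group rotation_group by (rule group_rotation_group)
  have "quadratic_form 0 = 0"
    using quadratic_form_diff [of 0 0] by (simp add: quadratic_form_def)
  then have "id \<in> infinitesimal_rotations"
    using R.one_closed
    by (simp add: infinitesimal_rotations_def one_rotation_group quadratic_form_nonneg)
  moreover have "infinitesimal_rotations \<subseteq> carrier rotation_group"
    by (auto simp: infinitesimal_rotations_def)
  ultimately have "subgroup infinitesimal_rotations rotation_group"
    by (intro R.subgroupI)
       (auto simp: mult_rotation_group infinitesimal_rotations_comp infinitesimal_rotations_inv)
  then show ?thesis
    using infinitesimal_rotations_conjugate by (simp add: R.normal_inv_iff)
qed

text \<open>The product sends \<open>u\<close> to its negative, so the displacement -2u has q = 4
  while q(u) = 1, and the condition already fails for \<open>m = 1\<close>.\<close>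

lemma reflection_comp_orthonormal_not_infinitesimal:
  assumes "b u u = 1" and "b v v = 1" and "b u v = 0"
  shows "reflection u \<circ> reflection v \<notin> infinitesimal_rotations"
proof
  assume "reflection u \<circ> reflection v \<in> infinitesimal_rotations"
  then have "leq (of_nat 1 * quadratic_form (reflection u (reflection v u) - u)) (quadratic_form u)"
    by (simp only: infinitesimal_rotations_def mem_Collect_eq comp_apply)
  moreover have "reflection u (reflection v u) - u = scale (- 2) u"
    using assms by (simp add: reflection_def quadratic_form_def scale_minus_left)
  ultimately have "leq 4 1"
    using assms by (simp add: quadratic_form_def b_bilinear)
  then have "leq 0 (- 3)"
    by (subst (asm) leq_iff_diff) simp
  then show False
    using of_nat_Suc_add_nonneg_neq_0 [of "- 3" 2] by simp
qed

section \<open>A non-central infinitesimal rotation\<close>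

lemma bessel:
  assumes "b u u = 1" and "b v v = 1" and "b u v = 0"
  shows "leq 0 (quadratic_form x - ((b x u)\<^sup>2 + (b x v)\<^sup>2))"
proof -
  \<comment> \<open>The argument is the component of \<open>x\<close> orthogonal to \<open>u\<close>
    and \<open>v\<close>.\<close>
  have "quadratic_form (x - (scale (b x u) u + scale (b x v) v))
      = quadratic_form x - ((b x u)\<^sup>2 + (b x v)\<^sup>2)"
    using assms symmetric [of v u] symmetric [of u x] symmetric [of v x]
    by (simp add: quadratic_form_def b_bilinear algebra_simps power2_eq_square)
  then show ?thesis
    using quadratic_form_nonneg by metis
qed

text \<open>If \<phi> is the angle between \<open>p\<close> and \<open>r\<close>, the product
  rotates the plane of \<open>u\<close> and \<open>v\<close> by 2\<phi> and fixes its orthogonal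
  complement. The factor is 4 (sin \<phi>)^2 with sin \<phi> = 2X / (1 + X^2).\<close>

lemma quadratic_form_reflection_diff:
  fixes X :: 'a
  assumes "b u u = 1" and "b v v = 1" and "b u v = 0"
  defines "p \<equiv> scale X u + v" and "r \<equiv> scale X u - v"
  shows "quadratic_form (reflection p (reflection r x) - x)
    = 16 * X\<^sup>2 / (1 + X\<^sup>2)\<^sup>2 * ((b x u)\<^sup>2 + (b x v)\<^sup>2)"
proof -
  let ?Q = "1 + X\<^sup>2"
  have vu: "b v u = 0"
    using assms(3) symmetric by metis
  have p: "quadratic_form p = ?Q" and r: "quadratic_form r = ?Q"
    using assms(1-3) vu
    by (simp_all add: p_def r_def quadratic_form_def b_bilinear power2_eq_square)
  have Q: "?Q \<noteq> 0"
    by (rule one_add_square_neq_0)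
  have iso: "isometry (reflection p)"
    using p Q by (simp add: isometry_reflection)
  \<comment> \<open>Writing \<open>x\<close> as \<open>reflection p (reflection p x)\<close> lets
    the outer isometry be cancelled, which leaves a difference of two single reflections.\<close>
  have "quadratic_form (reflection p (reflection r x) - x)
      = quadratic_form (reflection p (reflection r x) - reflection p (reflection p x))"
    using p Q by (simp add: reflection_reflection)
  also have "\<dots> = quadratic_form (reflection r x - reflection p x)"
    by (simp flip: isometry_diff [OF iso] add: isometry_quadratic_form iso)
  also have "reflection r x - reflection p x
      = scale (2 / ?Q) (scale (b x p) p - scale (b x r) r)"
    by (simp add: reflection_def p r scale_right_diff_distrib algebra_simps)
  \<comment> \<open>Only the cross terms survive the subtraction; this exchanges the two coordinates
    of \<open>x\<close>.\<close>
  also have "scale (b x p) p - scale (b x r) r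
      = scale (2 * X) (scale (b x v) u + scale (b x u) v)"
    by (simp add: p_def r_def b_bilinear scale_right_diff_distrib scale_right_distrib
        scale_left_diff_distrib scale_left_distrib algebra_simps flip: scale_left_distrib)
  also have "quadratic_form (scale (2 / ?Q) (scale (2 * X) (scale (b x v) u + scale (b x u) v)))
      = (2 / ?Q)\<^sup>2 * ((2 * X)\<^sup>2 * quadratic_form (scale (b x v) u + scale (b x u) v))"
    by (simp only: quadratic_form_scale)
  also have "quadratic_form (scale (b x v) u + scale (b x u) v) = (b x u)\<^sup>2 + (b x v)\<^sup>2"
    using assms(1-3) vu by (simp add: quadratic_form_def b_bilinear power2_eq_square)
  also have "(2 / ?Q)\<^sup>2 * ((2 * X)\<^sup>2 * ((b x u)\<^sup>2 + (b x v)\<^sup>2))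
      = 16 * X\<^sup>2 / ?Q\<^sup>2 * ((b x u)\<^sup>2 + (b x v)\<^sup>2)"
    by (simp add: power_divide power_mult_distrib)
  finally show ?thesis .
qed

text \<open>By the displacement formula and Bessel's inequality it is enough that 16 m X^2 \<le> (1
  + X^2)^2, which follows from 16 m \<le> X^2.\<close>

lemma reflection_comp_infinitesimal:
  assumes uv: "b u u = 1" "b v v = 1" "b u v = 0"
    and X: "\<And>m. 0 < m \<Longrightarrow> leq (of_nat m) X"
  shows "reflection (scale X u + v) \<circ> reflection (scale X u - v) \<in> infinitesimal_rotations"
proof -
  let ?Q = "1 + X\<^sup>2" and ?p = "scale X u + v" and ?r = "scale X u - v"
  have vu: "b v u = 0"
    using uv(3) symmetric by metis
  have Q: "?Q \<noteq> 0"
    by (rule one_add_square_neq_0)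
  have "quadratic_form ?p = ?Q" "quadratic_form ?r = ?Q" "quadratic_form (?p - ?r) = 4"
    using uv vu by (simp_all add: quadratic_form_def b_bilinear power2_eq_square)
  moreover have "(4 :: 'a) \<noteq> 0"
    using of_nat_Suc_neq_0 [of 3] by simp
  ultimately have "reflection ?p \<circ> reflection ?r \<in> carrier rotation_group"
    using Q by (intro reflection_comp_rotation) simp_all
  moreover have "leq (of_nat m * quadratic_form (reflection ?p (reflection ?r x) - x))
      (quadratic_form x)" for x m
  proof -
    define s where "s = (b x u)\<^sup>2 + (b x v)\<^sup>2"
    define M :: 'a where "M = of_nat (16 * m)"
    have M: "leq 0 M"
      by (simp only: M_def of_nat_nonneg)
    have X1: "leq 0 (X - 1)"
      using X [of 1] leq_iff_diff [of 1 X] by simp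
    then have X0: "leq 0 X"
      using add_nonneg [OF X1 one_nonneg] by simp
    \<comment> \<open>The assumption on \<open>X\<close> covers positive integers only, so
      \<open>m = 0\<close> is treated separately.\<close>
    have XM: "leq 0 (X - M)"
    proof (cases "m = 0")
      case False
      then show ?thesis
        using X [of "16 * m"] leq_iff_diff [of M X] by (simp add: M_def)
    qed (use X0 in \<open>simp add: M_def\<close>)
    \<comment> \<open>This sum equals \<open>X\<^sup>2 - M\<close>.\<close>
    have "leq 0 (X * (X - M) + M * (X - 1))"
      by (intro add_nonneg mult_nonneg X0 XM M X1)
    then have XXM: "leq 0 (X\<^sup>2 - M)"
      by (simp add: algebra_simps power2_eq_square)
    have "leq 0 (X\<^sup>2 * (X\<^sup>2 - M) + X\<^sup>2 + X\<^sup>2 + 1)"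
      by (intro add_nonneg mult_nonneg XXM square_nonneg one_nonneg)
    then have "leq 0 (?Q\<^sup>2 - M * X\<^sup>2)"
      by (simp add: algebra_simps power2_eq_square)
    \<comment> \<open>Division by a square is multiplication by the square of the inverse, which is
      nonnegative.\<close>
    then have "leq 0 ((inverse ?Q)\<^sup>2 * (?Q\<^sup>2 - M * X\<^sup>2))"
      by (intro mult_nonneg square_nonneg)
    also have "(inverse ?Q)\<^sup>2 * (?Q\<^sup>2 - M * X\<^sup>2) = 1 - M * X\<^sup>2 / ?Q\<^sup>2"
      using Q by (simp add: field_simps)
    finally have "leq 0 ((1 - M * X\<^sup>2 / ?Q\<^sup>2) * s + (quadratic_form x - s))"
      unfolding s_def by (intro add_nonneg mult_nonneg square_nonneg bessel uv)
    then have "leq 0 (quadratic_form x - M * X\<^sup>2 / ?Q\<^sup>2 * s)"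
      by (simp add: algebra_simps)
    moreover have "of_nat m * quadratic_form (reflection ?p (reflection ?r x) - x)
        = M * X\<^sup>2 / ?Q\<^sup>2 * s"
      by (simp only: quadratic_form_reflection_diff [OF uv] s_def M_def of_nat_mult
          of_nat_numeral mult.assoc times_divide_eq_right times_divide_eq_left mult.left_commute)
    ultimately show ?thesis
      by (subst leq_iff_diff) (simp only:)
  qed
  ultimately show ?thesis
    by (simp add: infinitesimal_rotations_def)
qed

text \<open>The product of the reflections in \<open>v\<close> and \<open>w\<close> fixes
  \<open>u\<close> and negates \<open>v\<close>. A rotation commuting with it maps \<open>u\<close>
  to a fixed vector, necessarily orthogonal to \<open>v\<close>; but the image of \<open>u\<close>
  here has a nonzero product with \<open>v\<close>.\<close>

lemma reflection_comp_not_central: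
  assumes uv: "b u u = 1" "b v v = 1" "b u v = 0"
    and w: "b w w = 1" "b u w = 0" "b v w = 0"
    and X: "X \<noteq> 0" "X\<^sup>2 \<noteq> 1"
  shows "reflection (scale X u + v) \<circ> reflection (scale X u - v) \<notin> group_center rotation_group"
proof
  let ?Q = "1 + X\<^sup>2" and ?p = "scale X u + v" and ?r = "scale X u - v"
  let ?R = "reflection ?p \<circ> reflection ?r" and ?S = "reflection v \<circ> reflection w"
  assume "?R \<in> group_center rotation_group"
  moreover have S: "?S \<in> carrier rotation_group"
    using uv w two_neq_0 symmetric [of w v]
    by (intro reflection_comp_rotation) (simp_all add: quadratic_form_def b_bilinear)
  ultimately have "?R \<circ> ?S = ?S \<circ> ?R"
    by (simp add: group_center_def mult_rotation_group)
  then have comm: "?R (?S u) = ?S (?R u)"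
    by (metis comp_apply)
  have vu: "b v u = 0"
    using uv(3) symmetric by metis
  have p: "quadratic_form ?p = ?Q" and r: "quadratic_form ?r = ?Q"
    using uv vu by (simp_all add: quadratic_form_def b_bilinear power2_eq_square)
  have Q: "?Q \<noteq> 0"
    by (rule one_add_square_neq_0)
  have Su: "?S u = u" and Sv: "?S v = - v"
    using uv w vu scale_left_diff_distrib [of 1 2 v]
    by (simp_all add: reflection_def quadratic_form_def)
  have SRu: "?S (?R u) = ?R u"
    using comm unfolding Su by (rule sym)
  have "b (?S (?R u)) (?S v) = b (?R u) v"
    using S by (intro isometry_b) (simp only: carrier_rotation_group)
  then have "b (?R u) v = - b (?R u) v"
    unfolding SRu Sv b_minus_right by (rule sym)
  then have "b (?R u) v + b (?R u) v = 0"
    by (simp only: eq_neg_iff_add_eq_0)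
  then have "b (?R u) v = 0"
    using two_neq_0 by (simp flip: mult_2)
  \<comment> \<open>The self-inverse isometry \<open>reflection ?p\<close> is moved to the other
    argument, so only single reflections have to be expanded.\<close>
  moreover have "b (?R u) v = b (reflection ?r u) (reflection ?p v)"
    using isometry_b [OF isometry_reflection, of ?p "?R u" v] p Q
    by (simp add: reflection_reflection)
  \<comment> \<open>The value is the sine of the rotation angle. The two terms linear in the
    reflection coefficients cancel, and only their product contributes.\<close>
  moreover have "b (reflection ?r u) (reflection ?p v) = 4 * X * (X\<^sup>2 - 1) / ?Q\<^sup>2"
  proof -
    have expand: "b (u - scale c y) (v - scale d z) = b u v - d * b u z - c * b y v + c * d * b y z"
      for c d y z
      by (simp add: b_bilinear algebra_simps)
    have products: "b u ?r = X" "b v ?p = 1" "b u ?p = X" "b ?r v = - 1" "b ?r ?p = X\<^sup>2 - 1"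
      using uv vu by (simp_all add: b_bilinear power2_eq_square)
    have "reflection ?r u = u - scale (2 * X / ?Q) ?r" and "reflection ?p v = v - scale (2 / ?Q) ?p"
      by (simp_all add: reflection_def p r products)
    then show ?thesis
      by (simp add: expand products uv power2_eq_square)
  qed
  moreover have "(4 :: 'a) \<noteq> 0"
    using of_nat_Suc_neq_0 [of 3] by simp
  ultimately show False
    using X Q by simp
qed

end

section \<open>Orthonormal vectors and the conclusion\<close>

lemma (in bilinear_space) isometric_to_sum_of_squares_orthonormal:
  assumes "isometric_to_sum_of_squares n" and "(2 :: 'a) \<noteq> 0"
  obtains e where "\<And>i j. i < n \<Longrightarrow> j < n \<Longrightarrow> b (e i) (e j) = (if i = j then 1 else 0)"
proof -
  obtain f where bij: "bij_betw f UNIV (carrier_vec n)"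
    and add: "\<And>x y. f (x + y) = f x + f y"
    and q: "\<And>x. quadratic_form x = (\<Sum>i<n. (f x $ i)\<^sup>2)"
    using assms(1) unfolding isometric_to_sum_of_squares_def by auto
  define e where "e i = inv_into UNIV f (unit_vec n i)" for i
  have fe: "f (e i) = unit_vec n i" for i
    using bij bij_betw_inv_into_right [OF bij] by (simp add: e_def)
  \<comment> \<open>The map \<open>f\<close> is only known to transport the quadratic form, so
    \<open>b\<close> is recovered by polarization, up to a factor 2 that is cancelled at the
    end.\<close>
  have polar: "2 * b x y = (\<Sum>k<n. 2 * (f x $ k * f y $ k))" for x y
  proof -
    have "f x \<in> carrier_vec n" "f y \<in> carrier_vec n"
      using bij by (auto simp: bij_betw_def)
    then have "2 * b x y
        = (\<Sum>k<n. (f x $ k + f y $ k)\<^sup>2) - (\<Sum>k<n. (f x $ k)\<^sup>2) - (\<Sum>k<n. (f y $ k)\<^sup>2)"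
      using quadratic_form_add [of x y] by (simp add: q add)
    also have "\<dots> = (\<Sum>k<n. 2 * (f x $ k * f y $ k))"
      by (simp add: power2_sum sum.distrib mult.assoc)
    finally show ?thesis .
  qed
  have "b (e i) (e j) = (if i = j then 1 else 0)" if "i < n" "j < n" for i j
  proof -
    have "2 * b (e i) (e j) = (\<Sum>k<n. if k = i then 2 * (if i = j then 1 else 0) else 0)"
      unfolding polar using that by (intro sum.cong) (auto simp: fe)
    then show ?thesis
      using that assms(2) by simp
  qed
  then show ?thesis
    by (rule that)
qed

theorem proposition3p4:
  fixes scale :: "'a::field \<Rightarrow> 'v::ab_group_add \<Rightarrow> 'v"
    and b :: "'v \<Rightarrow> 'v \<Rightarrow> 'a"
    and n :: nat
  assumes "pythagorean_field TYPE('a)"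
    and "formally_real_field TYPE('a)"
    and "bilinear_space scale b"
    and "vector_space.dim scale (UNIV :: 'v set) = n"
    and "n \<ge> 3"
    and "bilinear_space.isometric_to_sum_of_squares scale b n"
    and "\<exists>leq :: 'a \<Rightarrow> 'a \<Rightarrow> bool. field_ordering leq \<and> non_archimedean leq"
  shows "\<exists>N. N \<lhd> bilinear_space.rotation_group scale b \<and>
             N \<noteq> carrier (bilinear_space.rotation_group scale b) \<and>
             \<not> N \<subseteq> group_center (bilinear_space.rotation_group scale b)"
proof -
  obtain leq :: "'a \<Rightarrow> 'a \<Rightarrow> bool" and X
    where leq: "field_ordering leq"
      and X: "\<And>m. 0 < m \<Longrightarrow> leq (of_nat m) X \<and> of_nat m \<noteq> X"
    using assms(7) by (auto simp: non_archimedean_def)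
  interpret bilinear_space scale b by fact
  interpret ordering_of_field leq by unfold_locales (rule leq)
  interpret nonneg_bilinear_space scale b leq
  proof
    show "leq 0 (quadratic_form x)" for x
      using assms(6) unfolding isometric_to_sum_of_squares_def
      by (auto intro!: sum_nonneg square_nonneg)
  qed
  obtain e where e: "\<And>i j. i < n \<Longrightarrow> j < n \<Longrightarrow> b (e i) (e j) = (if i = j then 1 else 0)"
    using isometric_to_sum_of_squares_orthonormal [OF assms(6) two_neq_0] by blast
  have e: "b (e i) (e j) = (if i = j then 1 else 0)" if "i < 3" "j < 3" for i j
    using e [of i j] that assms(5) by simp
  define R where "R = reflection (scale X (e 0) + e 1) \<circ> reflection (scale X (e 0) - e 1)"
  \<comment> \<open>Writing X = 1 + (X - 1) and 1 + X = 2 + (X - 1) shows that both are nonzero; X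
    \<noteq> 1 comes from strictness at m = 1.\<close>
  have X1: "leq 0 (X - 1)"
    using X [of 1] leq_iff_diff [of 1 X] by simp
  have "X \<noteq> 1"
    using X [of 1] by auto
  moreover have "1 + X \<noteq> 0"
    using of_nat_Suc_add_nonneg_neq_0 [OF X1, of 1] by simp
  moreover have "X \<noteq> 0"
    using of_nat_Suc_add_nonneg_neq_0 [OF X1, of 0] by auto
  ultimately have X2: "X \<noteq> 0" "X\<^sup>2 \<noteq> 1"
    by (auto simp: power2_eq_1_iff)
  have "R \<in> infinitesimal_rotations"
    unfolding R_def using X by (intro reflection_comp_infinitesimal) (auto simp: e)
  moreover have "R \<notin> group_center rotation_group"
    unfolding R_def by (rule reflection_comp_not_central [of _ _ "e 2"]) (auto simp: e X2)
  moreover have "reflection (e 0) \<circ> reflection (e 1) \<in> carrier rotation_group"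
    by (rule reflection_comp_rotation)
       (auto simp: quadratic_form_def b_bilinear e two_neq_0)
  moreover have "reflection (e 0) \<circ> reflection (e 1) \<notin> infinitesimal_rotations"
    by (rule reflection_comp_orthonormal_not_infinitesimal) (auto simp: e)
  ultimately show ?thesis
    using infinitesimal_rotations_normal by blast
qed

end
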